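(* Assume that $\boldsymbol{\Gamma}$ is a $\mathcal G$-measurable, closed and convex valued mapping, that $j$ is a normal integrand such that $u\mapsto j(u,\boldsymbol{\xi})$ is differentiable $\mathbb P$-a.s., and that $j'_u(\mathbf u(\cdot),\boldsymbol\xi(\cdot))\in\mathcal U$ for all $\mathbf u\in\mathcal U$. Let $\mathbf u^\sharp$ be a solution of the problem $$\min_{\mathbf u\in\mathcal U} J(\mathbf u)\quad\text{s.t.}\quad \mathbf u\in\mathcal U^{\rm as}\cap\mathcal U^{\rm me}.$$ Then $$\mathbb E\big(j'_u(\mathbf u^\sharp,\boldsymbol\xi)\,\big|\,\mathcal G\big)\in-\partial\chi_{\mathcal U^{\rm as}}(\mathbf u^\sharp).$$
   Context: $(\Omega,\mathcal A,\mathbb P)$ is a probability space, $\mathcal G$ is a sub-$\sigma$-field of $\mathcal A$, $\boldsymbol\xi:\Omega\to\Xi:=\mathbb R^{d_\xi}$ is a random variable, $\mathbb U:=\mathbb R^{d_u}$, and $\mathcal U:=L^2(\Omega,\mathcal A,\mathbb P;\mathbb U)$. The function $j:\mathbb U\times\Xi\to\mathbb R$ is a normal integrand (in the sense of Rockafellar–Wets, Definition 14.27, with $u$ the decision argument and $\xi$ the measurable parameter), and $J:\mathcal U\to\mathbb R$ is the (finite-valued) function $J(\mathbf u):=\mathbb E(j(\mathbf u,\boldsymbol\xi))$. $\boldsymbol\Gamma:\Omega\rightrightarrows\mathbb U$ is a measurable set-valued mapping. The constraint sets are $$\mathcal U^{\rm as}:=\{\mathbf u\in\mathcal U:\ \mathbf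 u(\omega)\in\boldsymbol\Gamma(\omega)\ \mathbb P\text{-a.s.}\},\qquad \mathcal U^{\rm me}:=\{\mathbf u\in\mathcal U:\ \mathbf u\text{ is }\mathcal G\text{-measurable}\}.$$ For a subset $C$ of a Hilbert space, $\chi_C$ is its indicator function ($0$ on $C$, $+\infty$ elsewhere) and $\partial\chi_C(u)$ its subdifferential at $u\in C$ for convex $C$, i.e. $\{r:\langle r,v-u\rangle\le 0\ \forall v\in C\}$. Derivatives are identified with gradients through the Hilbert inner product. *)

theory Defs
  imports "HOL-Probability.Probability"
begin

section \<open>Set-valued mappings and normal integrands\<close>

definition measurable_set_valued ::
    "'t measure \<Rightarrow> ('t \<Rightarrow> 'b::topological_space set) \<Rightarrow> bool" where
  "measurable_set_valued N S \<longleftrightarrow>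
     (\<forall>V. open V \<longrightarrow> {t \<in> space N. S t \<inter> V \<noteq> {}} \<in> sets N)"

text \<open>Normal integrands in the sense of Rockafellar--Wets, Definition 14.27, restricted to
  real-valued integrands: the epigraphical mapping is closed-valued and measurable.\<close>

definition normal_integrand ::
    "'t measure \<Rightarrow> ('t \<Rightarrow> 'b::euclidean_space \<Rightarrow> real) \<Rightarrow> bool" where
  "normal_integrand N f \<longleftrightarrow>
     (\<forall>t \<in> space N. closed (epigraph UNIV (f t))) \<and>
     measurable_set_valued N (\<lambda>t. epigraph UNIV (f t))"

text \<open>The Riesz representative of the derivative; unspecified where \<open>f\<close> is not differentiable.\<close>

definition gradient :: "('b::real_inner \<Rightarrow> real) \<Rightarrow> 'b \<Rightarrow> 'b" where
  "gradient f x = (THE D. GDERIV f x :> D)"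


section \<open>The Hilbert space of square-integrable random vectors\<close>

text \<open>Elements of $L^2$ are represented by measurable functions, which are not identified when
  they agree almost surely. The inner product, the constraint sets and the expected cost respect
  almost sure equality of elements of $L^2$, and hence descend to equivalence classes.\<close>

definition L2 :: "'a measure \<Rightarrow> ('a \<Rightarrow> 'b::euclidean_space) set" where
  "L2 M = {f \<in> borel_measurable M. integrable M (\<lambda>\<omega>. (norm (f \<omega>))\<^sup>2)}"

definition L2_inner ::
    "'a measure \<Rightarrow> ('a \<Rightarrow> 'b::euclidean_space) \<Rightarrow> ('a \<Rightarrow> 'b) \<Rightarrow> real" where
  "L2_inner M f g = (\<integral>\<omega>. f \<omega> \<bullet> g \<omega> \<partial>M)"

text \<open>Conditional expectation of a random vector, taken coordinatewise.\<close>

definition vec_cond_exp ::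
    "'a measure \<Rightarrow> 'a measure \<Rightarrow> ('a \<Rightarrow> 'b::euclidean_space) \<Rightarrow> 'a \<Rightarrow> 'b" where
  "vec_cond_exp M G f = (\<lambda>\<omega>. \<Sum>b\<in>Basis. real_cond_exp M G (\<lambda>\<omega>'. f \<omega>' \<bullet> b) \<omega> *\<^sub>R b)"

definition chi :: "'v set \<Rightarrow> 'v \<Rightarrow> ereal" where
  "chi C v = (if v \<in> C then 0 else \<infinity>)"

definition subdifferential ::
    "'a measure \<Rightarrow> (('a \<Rightarrow> 'b::euclidean_space) \<Rightarrow> ereal) \<Rightarrow> ('a \<Rightarrow> 'b) \<Rightarrow> ('a \<Rightarrow> 'b) set" where
  "subdifferential M F u =
     {r \<in> L2 M. \<forall>v \<in> L2 M. F u + ereal (L2_inner M r (v - u)) \<le> F v}"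

lemma subdifferential_chi:
  assumes "C \<subseteq> L2 M" and "u \<in> C"
  shows "subdifferential M (chi C) u = {r \<in> L2 M. \<forall>v \<in> C. L2_inner M r (v - u) \<le> 0}"
  using assms unfolding subdifferential_def chi_def by (auto simp: subset_iff)


section \<open>The stochastic optimization problem\<close>

definition U_as ::
    "'a measure \<Rightarrow> ('a \<Rightarrow> 'b::euclidean_space set) \<Rightarrow> ('a \<Rightarrow> 'b) set" where
  "U_as M \<Gamma> = {u \<in> L2 M. AE \<omega> in M. u \<omega> \<in> \<Gamma> \<omega>}"

text \<open>Measurability with respect to \<open>G\<close> of an $L^2$-class means that it has a
  \<open>G\<close>-measurable representative (\<open>G\<close> need not contain the null sets of \<open>M\<close>).\<close>

definition U_me :: "'a measure \<Rightarrow> 'a measure \<Rightarrow> ('a \<Rightarrow> 'b::euclidean_space) set" where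
  "U_me M G = {u \<in> L2 M. \<exists>u' \<in> borel_measurable G. AE \<omega> in M. u \<omega> = u' \<omega>}"

definition expected_cost ::
    "'a measure \<Rightarrow> ('b \<Rightarrow> 'x \<Rightarrow> real) \<Rightarrow> ('a \<Rightarrow> 'x) \<Rightarrow> ('a \<Rightarrow> 'b) \<Rightarrow> real" where
  "expected_cost M j \<xi> u = (\<integral>\<omega>. j (u \<omega>) (\<xi> \<omega>) \<partial>M)"

text \<open>The random vector $j'_u(u, \xi)$ is only determined almost surely, so it is accessed through
  its representatives in $L^2$; it belongs to $L^2$ iff such a representative exists.\<close>

definition represents_partial_gradient ::
    "'a measure \<Rightarrow> ('b::euclidean_space \<Rightarrow> 'x \<Rightarrow> real) \<Rightarrow> ('a \<Rightarrow> 'x) \<Rightarrow> ('a \<Rightarrow> 'b) \<Rightarrow> ('a \<Rightarrow> 'b)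
      \<Rightarrow> bool" where
  "represents_partial_gradient M j \<xi> u g \<longleftrightarrow>
     g \<in> L2 M \<and> (AE \<omega> in M. g \<omega> = gradient (\<lambda>v. j v (\<xi> \<omega>)) (u \<omega>))"

end

theory Submission
  imports Defs
begin

text \<open>Let $p$ be the conditional expectation of the gradient at the solution $u$, and let
  $y$ be the pointwise projection of $u - p$ onto $\Gamma$, which is $G$-measurable. The direction
  $d = y - u$ is feasible, so the directional derivative of the cost along $d$ gives
  $E \langle p, d \rangle \ge 0$, whereas the variational inequality of the projection gives
  $|d|^2 \le - \langle p, d \rangle$. Hence $d = 0$, that is, $u$ is almost surely the projection
  of $u - p$ onto $\Gamma$, and $-p$ is pointwise normal to $\Gamma$ at $u$.

  The cost has directional derivatives without any growth condition: up to a factor 2, the largest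
  difference quotient at $\omega$ is bounded, by the mean value theorem, by a directional derivative
  at some $u(\omega) + s(\omega) d(\omega)$ with $s$ measurable and valued in $[0, 1]$, and the
  gradient at this $L^2$ point is square-integrable by assumption. So dominated convergence
  applies.\<close>

section \<open>Square-integrable random vectors\<close>

lemma L2_bound:
  assumes [measurable]: "f \<in> borel_measurable M" and "h \<in> L2 M"
    and le: "AE \<omega> in M. norm (f \<omega>) \<le> norm (h \<omega>)"
  shows "f \<in> L2 M"
proof -
  have "integrable M (\<lambda>\<omega>. (norm (h \<omega>))\<^sup>2)"
    using assms by (simp add: L2_def)
  then have "integrable M (\<lambda>\<omega>. (norm (f \<omega>))\<^sup>2)"
  proof (rule Bochner_Integration.integrable_bound)
    show "AE \<omega> in M. norm ((norm (f \<omega>))\<^sup>2) \<le> norm ((norm (h \<omega>))\<^sup>2)"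
      using le by eventually_elim (simp add: power_mono)
  qed simp
  then show ?thesis
    by (simp add: L2_def)
qed

lemma L2_add:
  assumes "f \<in> L2 M" "h \<in> L2 M"
  shows "(\<lambda>\<omega>. f \<omega> + h \<omega>) \<in> L2 M"
proof -
  have [measurable]: "f \<in> borel_measurable M" "h \<in> borel_measurable M"
    and "integrable M (\<lambda>\<omega>. 2 * (norm (f \<omega>))\<^sup>2 + 2 * (norm (h \<omega>))\<^sup>2)"
    using assms by (auto simp: L2_def)
  then have "integrable M (\<lambda>\<omega>. (norm (f \<omega> + h \<omega>))\<^sup>2)"
  proof (rule_tac Bochner_Integration.integrable_bound)
    show "AE \<omega> in M. norm ((norm (f \<omega> + h \<omega>))\<^sup>2)
        \<le> norm (2 * (norm (f \<omega>))\<^sup>2 + 2 * (norm (h \<omega>))\<^sup>2)"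
    proof (rule AE_I2)
      fix \<omega>
      have "(norm (f \<omega> + h \<omega>))\<^sup>2 \<le> (norm (f \<omega>) + norm (h \<omega>))\<^sup>2"
        by (simp add: norm_triangle_ineq power_mono)
      also have "\<dots> \<le> 2 * (norm (f \<omega>))\<^sup>2 + 2 * (norm (h \<omega>))\<^sup>2"
        using sum_squares_bound[of "norm (f \<omega>)" "norm (h \<omega>)"] by (simp add: power2_sum)
      finally show "norm ((norm (f \<omega> + h \<omega>))\<^sup>2)
          \<le> norm (2 * (norm (f \<omega>))\<^sup>2 + 2 * (norm (h \<omega>))\<^sup>2)"
        by simp
    qed
  qed auto
  then show ?thesis
    by (simp add: L2_def)
qed

lemma L2_uminus: "f \<in> L2 M \<Longrightarrow> (\<lambda>\<omega>. - f \<omega>) \<in> L2 M"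
  by (simp add: L2_def)

text \<open>The factor may depend on \<open>\<omega>\<close>: it will be the random position of an
  intermediate point on a segment.\<close>

lemma L2_scaleR_bounded:
  fixes s :: "'a \<Rightarrow> real"
  assumes "d \<in> L2 M" and [measurable]: "s \<in> borel_measurable M"
    and "\<And>\<omega>. 0 \<le> s \<omega> \<and> s \<omega> \<le> 1"
  shows "(\<lambda>\<omega>. s \<omega> *\<^sub>R d \<omega>) \<in> L2 M"
proof (rule L2_bound[OF _ \<open>d \<in> L2 M\<close>])
  have [measurable]: "d \<in> borel_measurable M"
    using assms by (simp add: L2_def)
  show "(\<lambda>\<omega>. s \<omega> *\<^sub>R d \<omega>) \<in> borel_measurable M"
    by simp
  show "AE \<omega> in M. norm (s \<omega> *\<^sub>R d \<omega>) \<le> norm (d \<omega>)"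
    using assms(3) by (intro AE_I2) (simp add: mult_left_le_one_le)
qed

lemma L2_sum:
  assumes "\<And>i. i \<in> I \<Longrightarrow> f i \<in> L2 M"
  shows "(\<lambda>\<omega>. \<Sum>i\<in>I. f i \<omega>) \<in> L2 M"
  using assms
proof (induction I rule: infinite_finite_induct)
  case (insert i I)
  then show ?case
    using L2_add[of "f i" M "\<lambda>\<omega>. \<Sum>i\<in>I. f i \<omega>"] by simp
qed (auto simp: L2_def)

lemma integrable_L2_inner:
  assumes "f \<in> L2 M" "h \<in> L2 M"
  shows "integrable M (\<lambda>\<omega>. f \<omega> \<bullet> h \<omega>)"
proof -
  have [measurable]: "f \<in> borel_measurable M" "h \<in> borel_measurable M"
    and "integrable M (\<lambda>\<omega>. (norm (f \<omega>))\<^sup>2 + (norm (h \<omega>))\<^sup>2)"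
    using assms by (auto simp: L2_def)
  then show ?thesis
  proof (rule_tac Bochner_Integration.integrable_bound)
    show "AE \<omega> in M. norm (f \<omega> \<bullet> h \<omega>) \<le> norm ((norm (f \<omega>))\<^sup>2 + (norm (h \<omega>))\<^sup>2)"
    proof (rule AE_I2)
      fix \<omega>
      have "\<bar>f \<omega> \<bullet> h \<omega>\<bar> \<le> norm (f \<omega>) * norm (h \<omega>)"
        by (rule Cauchy_Schwarz_ineq2)
      also have "\<dots> \<le> (norm (f \<omega>))\<^sup>2 + (norm (h \<omega>))\<^sup>2"
        using sum_squares_bound[of "norm (f \<omega>)" "norm (h \<omega>)"]
        using mult_nonneg_nonneg[OF norm_ge_zero[of "f \<omega>"] norm_ge_zero[of "h \<omega>"]] by linarith
      finally show "norm (f \<omega> \<bullet> h \<omega>) \<le> norm ((norm (f \<omega>))\<^sup>2 + (norm (h \<omega>))\<^sup>2)"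
        by simp
    qed
  qed auto
qed

section \<open>Conditional expectation of square-integrable vectors\<close>

context finite_measure_subalgebra
begin

text \<open>Conditional Jensen for the square: the squared conditional expectation is dominated by
  the conditional expectation of the square, which is integrable.\<close>

lemma real_cond_exp_L2:
  assumes "X \<in> L2 M"
  shows "real_cond_exp M F X \<in> L2 M"
proof -
  have [measurable]: "X \<in> borel_measurable M" and sq: "integrable M (\<lambda>\<omega>. (X \<omega>)\<^sup>2)"
    using assms by (auto simp: L2_def)
  \<comment> \<open>The constant 1 is square-integrable because the measure is finite.\<close>
  have "integrable M X"
    using integrable_L2_inner[OF assms, of "\<lambda>_. 1"] by (simp add: L2_def)
  moreover have "convex_on UNIV (\<lambda>x::real. x\<^sup>2)"
    by (rule f''_ge0_imp_convex[where f' = "\<lambda>x. 2 * x" and f'' = "\<lambda>_. 2"])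
      (auto intro!: derivative_eq_intros)
  ultimately have
    "AE \<omega> in M. (real_cond_exp M F X \<omega>)\<^sup>2 \<le> real_cond_exp M F (\<lambda>\<omega>. (X \<omega>)\<^sup>2) \<omega>"
    using sq by (intro real_cond_exp_jensens_inequality(2)[where I = UNIV]) auto
  then have "AE \<omega> in M. norm ((real_cond_exp M F X \<omega>)\<^sup>2)
      \<le> norm (real_cond_exp M F (\<lambda>\<omega>. (X \<omega>)\<^sup>2) \<omega>)"
    by eventually_elim auto
  then have "integrable M (\<lambda>\<omega>. (real_cond_exp M F X \<omega>)\<^sup>2)"
    by (intro Bochner_Integration.integrable_bound[OF real_cond_exp_int(1)[OF sq]]) auto
  then show ?thesis
    by (simp add: L2_def)
qed

lemma vec_cond_exp_L2:
  fixes f :: "'a \<Rightarrow> 'b::euclidean_space"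
  assumes "f \<in> L2 M"
  shows "vec_cond_exp M F f \<in> L2 M"
  unfolding vec_cond_exp_def
proof (rule L2_sum)
  fix b :: 'b assume b: "b \<in> Basis"
  have [measurable]: "f \<in> borel_measurable M"
    using assms by (simp add: L2_def)
  have "(\<lambda>\<omega>. f \<omega> \<bullet> b) \<in> L2 M"
    using b by (intro L2_bound[OF _ assms]) (auto simp: Basis_le_norm)
  then have "real_cond_exp M F (\<lambda>\<omega>. f \<omega> \<bullet> b) \<in> L2 M"
    by (rule real_cond_exp_L2)
  then show "(\<lambda>\<omega>. real_cond_exp M F (\<lambda>\<omega>'. f \<omega>' \<bullet> b) \<omega> *\<^sub>R b) \<in> L2 M"
    using b by (simp add: L2_def)
qed

lemma borel_measurable_vec_cond_exp: "vec_cond_exp M F f \<in> borel_measurable F"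
  unfolding vec_cond_exp_def by simp

text \<open>Pull-out property in each coordinate, with \<open>d \<omega> \<bullet> b\<close> as the
  \<open>F\<close>-measurable factor. It turns a first-order condition on the gradient into one on
  its conditional expectation.\<close>

lemma L2_inner_vec_cond_exp:
  fixes f d :: "'a \<Rightarrow> 'b::euclidean_space"
  assumes f: "f \<in> L2 M" and d: "d \<in> L2 M" and [measurable]: "d \<in> borel_measurable F"
  shows "L2_inner M (vec_cond_exp M F f) d = L2_inner M f d"
proof -
  have [measurable]: "f \<in> borel_measurable M" "d \<in> borel_measurable M"
    using assms by (auto simp: L2_def)
  have fd: "integrable M (\<lambda>\<omega>. (d \<omega> \<bullet> b) * (f \<omega> \<bullet> b))" if "b \<in> Basis" for b
    using that L2_bound[OF _ f, of "\<lambda>\<omega>. f \<omega> \<bullet> b"] L2_bound[OF _ d, of "\<lambda>\<omega>. d \<omega> \<bullet> b"]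
      integrable_L2_inner[of "\<lambda>\<omega>. d \<omega> \<bullet> b" M "\<lambda>\<omega>. f \<omega> \<bullet> b"]
    by (auto simp: Basis_le_norm)
  note ce = real_cond_exp_intg[OF fd]
  have "L2_inner M (vec_cond_exp M F f) d
      = (\<integral>\<omega>. (\<Sum>b\<in>Basis. (d \<omega> \<bullet> b) * real_cond_exp M F (\<lambda>\<omega>'. f \<omega>' \<bullet> b) \<omega>) \<partial>M)"
    unfolding L2_inner_def vec_cond_exp_def inner_sum_left
    by (simp add: inner_commute mult.commute)
  also have "\<dots> = (\<Sum>b\<in>Basis. \<integral>\<omega>. (d \<omega> \<bullet> b) * (f \<omega> \<bullet> b) \<partial>M)"
    using ce by (subst Bochner_Integration.integral_sum) auto
  also have "\<dots> = (\<integral>\<omega>. (\<Sum>b\<in>Basis. (d \<omega> \<bullet> b) * (f \<omega> \<bullet> b)) \<partial>M)"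
    using fd by (subst Bochner_Integration.integral_sum) auto
  also have "\<dots> = L2_inner M f d"
    unfolding L2_inner_def by (subst euclidean_inner) (simp add: mult.commute)
  finally show ?thesis .
qed

end

section \<open>Measurability of the projection onto a random convex set\<close>

lemma norm_closest_point_eq_infdist:
  "closed S \<Longrightarrow> S \<noteq> {} \<Longrightarrow> norm (x - closest_point S x) = infdist x S"
  by (simp add: infdist_eq_setdist setdist_closest_point dist_norm)

text \<open>The projection onto a convex set is half the gradient of \<open>x \<mapsto> |x|\<^sup>2 - infdist x S\<^sup>2\<close>.\<close>

lemma infdist_square_increment:
  fixes S :: "'b::euclidean_space set"
  assumes S: "closed S" "convex S" "S \<noteq> {}"
  shows "\<bar>(infdist (x + h) S)\<^sup>2 - (infdist x S)\<^sup>2 - 2 * (h \<bullet> (x - closest_point S x))\<bar>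
    \<le> 3 * (norm h)\<^sup>2"
proof -
  let ?P = "closest_point S"
  have P: "?P y \<in> S" for y
    using S by (simp add: closest_point_in_set)
  \<comment> \<open>The projection of \<open>y\<close> is a competitor for the distance from
    \<open>y + k\<close>; expanding the square gives the bound.\<close>
  have le: "(infdist (y + k) S)\<^sup>2 \<le> (infdist y S)\<^sup>2 + 2 * (k \<bullet> (y - ?P y)) + (norm k)\<^sup>2" for y k
  proof -
    have "infdist (y + k) S \<le> norm (y + k - ?P y)"
      using P[of y] infdist_le[of "?P y" S "y + k"] by (simp add: dist_norm)
    then have "(infdist (y + k) S)\<^sup>2 \<le> (norm ((y - ?P y) + k))\<^sup>2"
      by (simp add: infdist_nonneg power_mono algebra_simps)
    also have "\<dots> = (infdist y S)\<^sup>2 + 2 * (k \<bullet> (y - ?P y)) + (norm k)\<^sup>2"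
      unfolding norm_closest_point_eq_infdist[OF S(1,3), symmetric]
      by (simp add: power2_norm_eq_inner inner_add_left inner_add_right inner_commute)
    finally show ?thesis .
  qed
  \<comment> \<open>The lower bound is \<open>le\<close> read backwards, from \<open>x + h\<close>
    with increment \<open>- h\<close>. It involves the projection of \<open>x + h\<close>, which
    nonexpansiveness compares with that of \<open>x\<close>.\<close>
  have "norm (?P (x + h) - ?P x) \<le> norm h"
    using closest_point_lipschitz[OF S(2,1,3), of "x + h" x] by (simp add: dist_norm)
  then have "h \<bullet> (?P (x + h) - ?P x) \<le> (norm h)\<^sup>2"
    using order_trans[OF norm_cauchy_schwarz mult_left_mono[OF _ norm_ge_zero]]
    by (simp add: power2_eq_square)
  moreover have "(infdist x S)\<^sup>2 \<le> (infdist (x + h) S)\<^sup>2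
      - 2 * (h \<bullet> (x - ?P x)) + 2 * (h \<bullet> (?P (x + h) - ?P x)) - (norm h)\<^sup>2"
    using le[of "x + h" "- h"]
    by (simp add: inner_diff_right inner_add_right power2_norm_eq_inner)
  ultimately show ?thesis
    using le[of x h] zero_le_power2[of "norm h"] by linarith
qed

lemma measurable_set_valued_space:
  assumes "measurable_set_valued N S"
  shows "{t \<in> space N. S t \<noteq> {}} \<in> sets N"
  using assms open_UNIV unfolding measurable_set_valued_def by fastforce

text \<open>The distance is measurable in \<open>t\<close> at a fixed point and Lipschitz in the
  point, so a moving point can be handled through a countable dense set.\<close>

lemma borel_measurable_infdist_set_valued:
  fixes S :: "'a \<Rightarrow> 'b::euclidean_space set"
  assumes S: "measurable_set_valued N S" and ne: "\<And>t. S t \<noteq> {}"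
    and [measurable]: "w \<in> borel_measurable N"
  shows "(\<lambda>t. infdist (w t) (S t)) \<in> borel_measurable N"
proof -
  have fixed: "(\<lambda>t. infdist x (S t)) \<in> borel_measurable N" for x
  proof (rule borel_measurableI_less)
    fix r :: real
    have "(infdist x (S t) < r) = (S t \<inter> ball x r \<noteq> {})" for t
      using ne[of t] by (auto simp: infdist_def cINF_less_iff)
    then show "{t \<in> space N. infdist x (S t) < r} \<in> sets N"
      using S by (simp add: measurable_set_valued_def)
  qed
  obtain D :: "'b set" where D: "countable D" "\<And>X. open X \<Longrightarrow> X \<noteq> {} \<Longrightarrow> \<exists>d\<in>D. d \<in> X"
    using countable_dense_setE by blast
  show ?thesis
  proof (rule borel_measurableI_less)
    fix r :: real
    have "(infdist (w t) (S t) < r) = (\<exists>d\<in>D. dist (w t) d + infdist d (S t) < r)" for t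
    proof
      assume less: "infdist (w t) (S t) < r"
      \<comment> \<open>Half of the slack, because the distance from \<open>w t\<close> to
        \<open>d\<close> is paid twice: once directly, once in comparing the two values of
        \<open>infdist\<close>.\<close>
      then obtain d where "d \<in> D" "d \<in> ball (w t) ((r - infdist (w t) (S t)) / 2)"
        using D(2)[of "ball (w t) ((r - infdist (w t) (S t)) / 2)"] by auto
      then show "\<exists>d\<in>D. dist (w t) d + infdist d (S t) < r"
        using infdist_triangle[of d "S t" "w t"]
        by (intro bexI[of _ d]) (auto simp: dist_commute field_simps)
    next
      assume "\<exists>d\<in>D. dist (w t) d + infdist d (S t) < r"
      then show "infdist (w t) (S t) < r"
        using infdist_triangle[of "w t" "S t"] by (force simp: add.commute intro: le_less_trans)
    qed
    then have "{t \<in> space N. infdist (w t) (S t) < r}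
        = (\<Union>d\<in>D. {t \<in> space N. dist (w t) d + infdist d (S t) < r})"
      by auto
    also have "\<dots> \<in> sets N"
      using D(1) fixed by (intro sets.countable_UN') auto
    finally show "{t \<in> space N. infdist (w t) (S t) < r} \<in> sets N" .
  qed
qed

text \<open>The coordinates of \<open>w t\<close> minus its projection are pointwise limits of
  difference quotients of half the squared distance, which is measurable.\<close>

lemma borel_measurable_closest_point:
  fixes S :: "'a \<Rightarrow> 'b::euclidean_space set"
  assumes S: "measurable_set_valued N S"
    and cc: "\<And>t. closed (S t)" "\<And>t. convex (S t)" "\<And>t. S t \<noteq> {}"
    and w[measurable]: "w \<in> borel_measurable N"
  shows "(\<lambda>t. closest_point (S t) (w t)) \<in> borel_measurable N"
proof -
  have "(\<lambda>t. b \<bullet> (w t - closest_point (S t) (w t))) \<in> borel_measurable N" if "b \<in> Basis" for b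
  proof (rule borel_measurable_LIMSEQ_real)
    let ?q = "\<lambda>n t. real (Suc n) / 2
      * ((infdist (w t + (1 / real (Suc n)) *\<^sub>R b) (S t))\<^sup>2 - (infdist (w t) (S t))\<^sup>2)"
    note borel_measurable_infdist_set_valued[OF S cc(3), measurable]
    show "?q n \<in> borel_measurable N" for n
      by measurable
    fix t
    let ?c = "b \<bullet> (w t - closest_point (S t) (w t))"
    \<comment> \<open>Basis vectors have norm 1, so the increment \<open>b / (n + 1)\<close> leaves
      an error of at most \<open>3 / (n + 1)^2\<close>, which \<open>?q\<close> multiplies by
      \<open>(n + 1) / 2\<close>.\<close>
    have "\<bar>?q n t - ?c\<bar> \<le> (3 / 2) * (1 / real (Suc n))" for n
    proof -
      let ?m = "real (Suc n)"
      let ?\<delta> = "(infdist (w t + (1 / ?m) *\<^sub>R b) (S t))\<^sup>2 - (infdist (w t) (S t))\<^sup>2"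
      have "\<bar>?\<delta> - 2 * (1 / ?m * ?c)\<bar> \<le> 3 * (1 / ?m)\<^sup>2"
        using infdist_square_increment[OF cc, where x = "w t" and h = "(1 / ?m) *\<^sub>R b"] that
        by simp
      then have "?m / 2 * \<bar>?\<delta> - 2 * (1 / ?m * ?c)\<bar> \<le> ?m / 2 * (3 * (1 / ?m)\<^sup>2)"
        by (intro mult_left_mono) auto
      moreover have "?q n t - ?c = ?m / 2 * (?\<delta> - 2 * (1 / ?m * ?c))"
        by (simp add: right_diff_distrib del: of_nat_Suc)
      then have "\<bar>?q n t - ?c\<bar> = ?m / 2 * \<bar>?\<delta> - 2 * (1 / ?m * ?c)\<bar>"
        by (simp only: abs_mult abs_divide abs_of_nat abs_numeral)
      moreover have "?m / 2 * (3 * (1 / ?m)\<^sup>2) = (3 / 2) * (1 / ?m)"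
        by (simp add: power2_eq_square del: of_nat_Suc)
      ultimately show ?thesis
        by linarith
    qed
    moreover have "(\<lambda>n. (3 / 2) * (1 / real (Suc n))) \<longlonglongrightarrow> 0"
      using tendsto_mult_left[OF LIMSEQ_inverse_real_of_nat, of "3 / 2"]
      by (simp add: inverse_eq_divide del: of_nat_Suc)
    ultimately have "(\<lambda>n. ?q n t - ?c) \<longlonglongrightarrow> 0"
      by (rule_tac Lim_null_comparison[OF always_eventually]) (simp_all only: real_norm_def simp_thms)
    then show "(\<lambda>n. ?q n t) \<longlonglongrightarrow> ?c"
      by (simp only: LIM_zero_iff)
  qed
  then have "(\<lambda>t. w t - closest_point (S t) (w t)) \<in> borel_measurable N"
    by (subst borel_measurable_euclidean_space) (simp add: inner_commute)
  then have "(\<lambda>t. w t - (w t - closest_point (S t) (w t))) \<in> borel_measurable N"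
    by (rule borel_measurable_diff[OF w])
  then show ?thesis
    by simp
qed

section \<open>Directional differentiability of the expected cost\<close>

text \<open>The values of the derivative on the basis are the coordinates of its Riesz
  representative; uniqueness of that vector makes the description in \<open>gradient\<close> denote
  it.\<close>

lemma gradient_GDERIV:
  fixes f :: "'b::euclidean_space \<Rightarrow> real"
  assumes "f differentiable (at x)"
  shows "GDERIV f x :> gradient f x"
proof -
  obtain f' where f': "(f has_derivative f') (at x)"
    using assms by (auto simp: differentiable_def)
  then have lin: "linear f'"
    by (rule has_derivative_linear)
  have "f' h = h \<bullet> (\<Sum>b\<in>Basis. f' b *\<^sub>R b)" for h
  proof -
    have "f' h = f' (\<Sum>b\<in>Basis. (h \<bullet> b) *\<^sub>R b)"
      by (simp add: euclidean_representation)
    also have "\<dots> = (\<Sum>b\<in>Basis. (h \<bullet> b) * f' b)"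
      by (simp add: linear_sum[OF lin] linear_scale[OF lin])
    finally show ?thesis
      by (simp add: inner_sum_right mult.commute)
  qed
  then have "f' = (\<lambda>h. h \<bullet> (\<Sum>b\<in>Basis. f' b *\<^sub>R b))"
    by blast
  then have ex: "GDERIV f x :> (\<Sum>b\<in>Basis. f' b *\<^sub>R b)"
    using f' by (simp add: gderiv_def)
  have "D = E" if "GDERIV f x :> D" "GDERIV f x :> E" for D E
    using has_derivative_unique[OF that[unfolded gderiv_def]]
    by (metis inner_commute vector_eq_rdot)
  then show ?thesis
    unfolding gradient_def using ex by (metis (no_types, lifting) theI)
qed

lemma has_real_derivative_along_line:
  fixes f :: "'b::euclidean_space \<Rightarrow> real"
  assumes "f differentiable (at (x + s *\<^sub>R d))"
  shows "((\<lambda>s. f (x + s *\<^sub>R d)) has_real_derivative (gradient f (x + s *\<^sub>R d) \<bullet> d)) (at s)"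
proof -
  have "(f has_derivative (\<lambda>h. h \<bullet> gradient f (x + s *\<^sub>R d))) (at (x + s *\<^sub>R d))"
    using gradient_GDERIV[OF assms] by (simp add: gderiv_def)
  moreover have "((\<lambda>s. x + s *\<^sub>R d) has_derivative (\<lambda>h. h *\<^sub>R d)) (at s)"
    by (auto intro!: derivative_eq_intros)
  ultimately have "((\<lambda>s. f (x + s *\<^sub>R d)) has_derivative
      (\<lambda>h. (h *\<^sub>R d) \<bullet> gradient f (x + s *\<^sub>R d))) (at s)"
    by (rule has_derivative_compose[rotated])
  moreover have "(\<lambda>h. (h *\<^sub>R d) \<bullet> D) = (*) (D \<bullet> d)" for D
    by (auto simp: fun_eq_iff inner_commute)
  ultimately show ?thesis
    by (simp only: has_field_derivative_def)
qed

section \<open>A mean value inequality with a measurable intermediate point\<close>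

lemma abs_DERIV_ge_of_shrinking_chords:
  fixes F :: "real \<Rightarrow> real"
  assumes F: "(F has_real_derivative D) (at s)"
    and ab: "\<And>n. a n \<le> s" "\<And>n. s \<le> b n" "\<And>n. a n < b n" "(\<lambda>n. b n - a n) \<longlonglongrightarrow> 0"
    and slope: "\<And>n. c * (b n - a n) \<le> \<bar>F (b n) - F (a n)\<bar>"
  shows "c \<le> \<bar>D\<bar>"
proof (rule field_le_epsilon)
  fix e :: real assume "e > 0"
  then obtain \<delta> where "\<delta> > 0" and
    \<delta>: "\<And>y. \<bar>y - s\<bar> < \<delta> \<Longrightarrow> \<bar>F y - F s - D * (y - s)\<bar> \<le> e * \<bar>y - s\<bar>"
    using F unfolding has_field_derivative_def has_derivative_at_alt by (force simp: mult.commute)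
  obtain n where n: "b n - a n < \<delta>"
    using order_tendstoD(2)[OF ab(4) \<open>\<delta> > 0\<close>] by (auto simp: eventually_sequentially)
  \<comment> \<open>As \<open>s\<close> lies between \<open>a n\<close> and \<open>b n\<close>, the
    errors at the two endpoints add up to \<open>e\<close> times the length, so the chord slope
    differs from \<open>D\<close> by at most \<open>e\<close>.\<close>
  have "\<bar>F (b n) - F s - D * (b n - s)\<bar> \<le> e * (b n - s)"
    using \<delta>[of "b n"] n ab(1-3)[of n] by auto
  moreover have "\<bar>F (a n) - F s - D * (a n - s)\<bar> \<le> e * (s - a n)"
    using \<delta>[of "a n"] n ab(1-3)[of n] by auto
  ultimately have "\<bar>(F (b n) - F (a n)) - D * (b n - a n)\<bar> \<le> e * (b n - a n)"
    by (simp add: algebra_simps abs_le_iff)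
  then have "\<bar>F (b n) - F (a n)\<bar> \<le> \<bar>D * (b n - a n)\<bar> + e * (b n - a n)"
    by linarith
  moreover have "\<bar>D * (b n - a n)\<bar> = \<bar>D\<bar> * (b n - a n)"
    using ab(3)[of n] by (simp add: abs_mult)
  ultimately have "c * (b n - a n) \<le> (\<bar>D\<bar> + e) * (b n - a n)"
    using slope[of n] by (simp add: distrib_right)
  then show "c \<le> \<bar>D\<bar> + e"
    using ab(3)[of n] by simp
qed

text \<open>The intermediate point is found by bisection, keeping at each step the half with the
  steeper chord; this makes it measurable without any measurable selection theorem.\<close>

fun bisect :: "(real \<Rightarrow> real) \<Rightarrow> real \<Rightarrow> nat \<Rightarrow> real \<times> real" where
  "bisect F t 0 = (0, t)"
| "bisect F t (Suc n) = (let (a, b) = bisect F t n; m = (a + b) / 2 in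
     if \<bar>F b - F m\<bar> \<le> \<bar>F m - F a\<bar> then (a, m) else (m, b))"

lemma bisect_props:
  fixes F :: "real \<Rightarrow> real" and t :: real
  assumes "0 < t"
  defines "a \<equiv> \<lambda>n. fst (bisect F t n)" and "b \<equiv> \<lambda>n. snd (bisect F t n)"
  shows "b n - a n = t / 2 ^ n"
    and "a n \<le> a (Suc n)" and "b (Suc n) \<le> b n" and "0 \<le> a n" and "b n \<le> t"
    and "\<bar>F t - F 0\<bar> / t * (b n - a n) \<le> \<bar>F (b n) - F (a n)\<bar>"
proof -
  have len: "b n - a n = t / 2 ^ n" for n
    by (induction n) (auto simp: a_def b_def Let_def split_beta field_simps)
  then show "b n - a n = t / 2 ^ n" .
  have pos: "a n < b n" for n
    using len[of n] divide_pos_pos[OF assms(1), of "2 ^ n"] by simp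
  show a: "a n \<le> a (Suc n)" and b: "b (Suc n) \<le> b n" for n
    using pos[of n] by (auto simp: a_def b_def Let_def split_beta)
  show "0 \<le> a n"
    by (induction n) (use a in \<open>auto simp: a_def intro: order_trans\<close>)
  show "b n \<le> t"
    by (induction n) (use b in \<open>auto simp: b_def intro: order_trans\<close>)
  show "\<bar>F t - F 0\<bar> / t * (b n - a n) \<le> \<bar>F (b n) - F (a n)\<bar>"
  proof (induction n)
    case 0
    then show ?case
      using assms by (simp add: a_def b_def)
  next
    case (Suc n)
    \<comment> \<open>The kept half carries at least half of the increment and has exactly half of
      the length, so its chord is at least as steep.\<close>
    have "\<bar>F (b n) - F (a n)\<bar>
        \<le> \<bar>F (b n) - F ((a n + b n) / 2)\<bar> + \<bar>F ((a n + b n) / 2) - F (a n)\<bar>"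
      by linarith
    then have "\<bar>F (b n) - F (a n)\<bar> \<le> 2 * \<bar>F (b (Suc n)) - F (a (Suc n))\<bar>"
      by (auto simp: a_def b_def Let_def split_beta)
    moreover have half: "b (Suc n) - a (Suc n) = (b n - a n) / 2"
      by (simp add: len)
    ultimately show ?case
      using Suc unfolding half by simp
  qed
qed

text \<open>Bisection shrinks to a point where any derivative is at least as steep as the chord.
  Measurability of \<open>F\<close> is asked along measurable points of \<open>[0, 1]\<close>, which
  is what integrability of the cost on \<open>L2\<close> provides; quantifying over \<open>D\<close>
  allows for differentiability that holds only almost surely.\<close>

lemma measurable_mean_value:
  fixes F :: "'a \<Rightarrow> real \<Rightarrow> real"
  assumes F: "\<And>s. s \<in> borel_measurable M \<Longrightarrow> (\<And>\<omega>. 0 \<le> s \<omega> \<and> s \<omega> \<le> 1)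
      \<Longrightarrow> (\<lambda>\<omega>. F \<omega> (s \<omega>)) \<in> borel_measurable M"
    and [measurable]: "t \<in> borel_measurable M" and t: "\<And>\<omega>. 0 < t \<omega> \<and> t \<omega> \<le> 1"
  obtains s where "s \<in> borel_measurable M" "\<And>\<omega>. 0 \<le> s \<omega> \<and> s \<omega> \<le> 1"
    "\<And>\<omega> D. (F \<omega> has_real_derivative D) (at (s \<omega>)) \<Longrightarrow> \<bar>F \<omega> (t \<omega>) - F \<omega> 0\<bar> \<le> \<bar>D\<bar> * t \<omega>"
proof -
  define a where "a = (\<lambda>n \<omega>. fst (bisect (F \<omega>) (t \<omega>) n))"
  define b where "b = (\<lambda>n \<omega>. snd (bisect (F \<omega>) (t \<omega>) n))"
  have len: "b n \<omega> - a n \<omega> = t \<omega> / 2 ^ n" for n \<omega>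
    unfolding a_def b_def using bisect_props(1) t by blast
  have inca: "a n \<omega> \<le> a (Suc n) \<omega>" and decb: "b (Suc n) \<omega> \<le> b n \<omega>"
    and a0: "0 \<le> a n \<omega>" and bt: "b n \<omega> \<le> t \<omega>" for n \<omega>
    unfolding a_def b_def using bisect_props t by blast+
  have slope: "\<bar>F \<omega> (t \<omega>) - F \<omega> 0\<bar> / t \<omega> * (b n \<omega> - a n \<omega>) \<le> \<bar>F \<omega> (b n \<omega>) - F \<omega> (a n \<omega>)\<bar>" for n \<omega>
    unfolding a_def b_def using bisect_props(6) t by blast
  have less: "a n \<omega> < b n \<omega>" for n \<omega>
  proof -
    have "0 < t \<omega> / 2 ^ n"
      using t by simp
    then show ?thesis
      using len[of n \<omega>] by linarith
  qed
  \<comment> \<open>The choice of a half compares \<open>F\<close> at the endpoints and the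
    midpoint, which are measurable points of \<open>[0, 1]\<close> by induction, so the hypothesis
    on \<open>F\<close> applies.\<close>
  have "a n \<in> borel_measurable M \<and> b n \<in> borel_measurable M" for n
  proof (induction n)
    case 0
    then show ?case
      by (simp add: a_def b_def)
  next
    case (Suc n)
    then have [measurable]: "a n \<in> borel_measurable M" "b n \<in> borel_measurable M"
      by auto
    have range: "0 \<le> a n \<omega> \<and> a n \<omega> \<le> 1" "0 \<le> b n \<omega> \<and> b n \<omega> \<le> 1"
      "0 \<le> (a n \<omega> + b n \<omega>) / 2 \<and> (a n \<omega> + b n \<omega>) / 2 \<le> 1" for \<omega>
      using a0[of n \<omega>] bt[of n \<omega>] less[of n \<omega>] t[of \<omega>] by auto
    have [measurable]: "(\<lambda>\<omega>. F \<omega> (a n \<omega>)) \<in> borel_measurable M"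
      "(\<lambda>\<omega>. F \<omega> (b n \<omega>)) \<in> borel_measurable M"
      "(\<lambda>\<omega>. F \<omega> ((a n \<omega> + b n \<omega>) / 2)) \<in> borel_measurable M"
      by (intro F range; measurable)+
    let ?left = "\<lambda>\<omega>. \<bar>F \<omega> (b n \<omega>) - F \<omega> ((a n \<omega> + b n \<omega>) / 2)\<bar>
      \<le> \<bar>F \<omega> ((a n \<omega> + b n \<omega>) / 2) - F \<omega> (a n \<omega>)\<bar>"
    have "a (Suc n) = (\<lambda>\<omega>. if ?left \<omega> then a n \<omega> else (a n \<omega> + b n \<omega>) / 2)"
      "b (Suc n) = (\<lambda>\<omega>. if ?left \<omega> then (a n \<omega> + b n \<omega>) / 2 else b n \<omega>)"
      by (auto simp: a_def b_def Let_def split_beta)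
    then show ?case
      by simp
  qed
  then have meas: "a n \<in> borel_measurable M" for n
    by simp
  \<comment> \<open>The common point of the nested intervals, as the limit of the increasing left
    endpoints.\<close>
  define s where "s = (\<lambda>\<omega>. SUP n. a n \<omega>)"
  have amono: "incseq (\<lambda>n. a n \<omega>)" and bmono: "decseq (\<lambda>n. b n \<omega>)" for \<omega>
    using inca decb by (auto intro: incseq_SucI decseq_SucI)
  have a_le_b: "a m \<omega> \<le> b n \<omega>" for m n \<omega>
  proof -
    have "a m \<omega> \<le> a (max m n) \<omega>"
      using amono by (auto simp: incseq_def)
    also have "\<dots> \<le> b (max m n) \<omega>"
      using less by (simp add: less_imp_le)
    also have "\<dots> \<le> b n \<omega>"
      using bmono by (auto simp: decseq_def)
    finally show ?thesis .
  qed
  then have bdd: "bdd_above (range (\<lambda>n. a n \<omega>))" for \<omega>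
    by (intro bdd_aboveI2[where M = "b 0 \<omega>"])
  have as: "a n \<omega> \<le> s \<omega>" and sb: "s \<omega> \<le> b n \<omega>" for n \<omega>
    unfolding s_def using bdd a_le_b by (auto intro: cSUP_upper cSUP_least)
  have "s \<in> borel_measurable M"
  proof (rule borel_measurable_LIMSEQ_real[OF _ meas])
    show "(\<lambda>n. a n \<omega>) \<longlonglongrightarrow> s \<omega>" for \<omega>
      unfolding s_def by (intro LIMSEQ_incseq_SUP bdd amono)
  qed
  moreover have "0 \<le> s \<omega> \<and> s \<omega> \<le> 1" for \<omega>
    using as[of 0 \<omega>] sb[of \<omega> 0] a0[of 0 \<omega>] bt[of 0 \<omega>] t[of \<omega>] by auto
  moreover have "\<bar>F \<omega> (t \<omega>) - F \<omega> 0\<bar> \<le> \<bar>D\<bar> * t \<omega>"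
    if "(F \<omega> has_real_derivative D) (at (s \<omega>))" for \<omega> D
  proof -
    have "(\<lambda>n. t \<omega> * (1 / 2) ^ n) \<longlonglongrightarrow> 0"
      by (intro tendsto_mult_right_zero LIMSEQ_realpow_zero) auto
    then have "(\<lambda>n. b n \<omega> - a n \<omega>) \<longlonglongrightarrow> 0"
      by (simp add: len power_one_over)
    then have "\<bar>F \<omega> (t \<omega>) - F \<omega> 0\<bar> / t \<omega> \<le> \<bar>D\<bar>"
      using abs_DERIV_ge_of_shrinking_chords[where a = "\<lambda>n. a n \<omega>" and b = "\<lambda>n. b n \<omega>",
          OF that as sb less _ slope] by blast
    then show ?thesis
      using t[of \<omega>] by (simp only: pos_divide_le_eq)
  qed
  ultimately show ?thesis
    by (rule that)
qed

section \<open>Differentiation under the expectation\<close>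

lemma expected_cost_directional_derivative:
  fixes j :: "'b::euclidean_space \<Rightarrow> 'x \<Rightarrow> real"
  assumes J_finite: "\<And>u. u \<in> L2 M \<Longrightarrow> integrable M (\<lambda>\<omega>. j (u \<omega>) (\<xi> \<omega>))"
    and diff: "AE \<omega> in M. \<forall>v. (\<lambda>u. j u (\<xi> \<omega>)) differentiable (at v)"
    and grad: "\<And>u. u \<in> L2 M \<Longrightarrow> \<exists>h. represents_partial_gradient M j \<xi> u h"
    and u: "u \<in> L2 M" and d: "d \<in> L2 M" and g: "represents_partial_gradient M j \<xi> u g"
  shows "(\<lambda>n. real (Suc n) * (expected_cost M j \<xi> (\<lambda>\<omega>. u \<omega> + (1 / real (Suc n)) *\<^sub>R d \<omega>)
      - expected_cost M j \<xi> u)) \<longlonglongrightarrow> L2_inner M g d"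
proof -
  define F where "F = (\<lambda>\<omega> s. j (u \<omega> + s *\<^sub>R d \<omega>) (\<xi> \<omega>))"
  define q where "q = (\<lambda>n \<omega>. real (Suc n) * (F \<omega> (1 / real (Suc n)) - F \<omega> 0))"
  have line: "(\<lambda>\<omega>. u \<omega> + s \<omega> *\<^sub>R d \<omega>) \<in> L2 M"
    if "s \<in> borel_measurable M" "\<And>\<omega>. 0 \<le> s \<omega> \<and> s \<omega> \<le> 1" for s :: "'a \<Rightarrow> real"
    using L2_add[OF u L2_scaleR_bounded[OF d that]] .
  have Fint: "integrable M (\<lambda>\<omega>. F \<omega> (s \<omega>))"
    if "s \<in> borel_measurable M" "\<And>\<omega>. 0 \<le> s \<omega> \<and> s \<omega> \<le> 1" for s :: "'a \<Rightarrow> real"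
    unfolding F_def by (rule J_finite[OF line[OF that]])
  have F_const: "integrable M (\<lambda>\<omega>. F \<omega> s)" if "0 \<le> s" "s \<le> 1" for s
    using Fint[of "\<lambda>_. s"] that by simp
  have qint: "integrable M (q n)" for n
    unfolding q_def by (intro integrable_mult_right Bochner_Integration.integrable_diff F_const) auto
  then have [measurable]: "q n \<in> borel_measurable M" for n
    by auto
  have deriv: "AE \<omega> in M. \<forall>s. (F \<omega> has_real_derivative
      (gradient (\<lambda>v. j v (\<xi> \<omega>)) (u \<omega> + s *\<^sub>R d \<omega>) \<bullet> d \<omega>)) (at s)"
    using diff unfolding F_def by eventually_elim (auto intro: has_real_derivative_along_line)
  have g_L2: "g \<in> L2 M" and g_eq: "AE \<omega> in M. g \<omega> = gradient (\<lambda>v. j v (\<xi> \<omega>)) (u \<omega>)"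
    using g by (auto simp: represents_partial_gradient_def)
  have q_lim: "AE \<omega> in M. (\<lambda>n. q n \<omega>) \<longlonglongrightarrow> g \<omega> \<bullet> d \<omega>"
    using deriv g_eq
  proof eventually_elim
    case (elim \<omega>)
    then have "(F \<omega> has_real_derivative (g \<omega> \<bullet> d \<omega>)) (at 0)"
      by (metis add.right_neutral scale_zero_left)
    then have "(\<lambda>h. (F \<omega> (0 + h) - F \<omega> 0) / h) \<midarrow>0\<rightarrow> g \<omega> \<bullet> d \<omega>"
      by (simp only: DERIV_def)
    then have "(\<lambda>n. (F \<omega> (0 + 1 / real (Suc n)) - F \<omega> 0) / (1 / real (Suc n))) \<longlonglongrightarrow> g \<omega> \<bullet> d \<omega>"
    proof (rule filterlim_compose)
      show "filterlim (\<lambda>n. 1 / real (Suc n)) (at 0) sequentially"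
        using LIMSEQ_Suc[OF lim_1_over_n] by (auto simp: filterlim_at)
    qed
    then show ?case
      by (simp add: q_def mult.commute)
  qed

  \<comment> \<open>An index at which the difference quotient is at least half its supremum; the mean value
    theorem then bounds all difference quotients by one directional derivative along an \<open>L2\<close> vector.\<close>
  define N where "N = (\<lambda>\<omega>. LEAST n. \<forall>m. \<bar>q m \<omega>\<bar> \<le> 2 * \<bar>q n \<omega>\<bar>)"
  have [measurable]: "N \<in> measurable M (count_space UNIV)"
    unfolding N_def by measurable
  \<comment> \<open>The step of the selected quotient. It lies in \<open>(0, 1]\<close> for every
    \<open>\<omega>\<close>, even where no index has the desired property and \<open>LEAST\<close>
    is arbitrary.\<close>
  define t where "t = (\<lambda>\<omega>. 1 / real (Suc (N \<omega>)))"
  have t: "t \<in> borel_measurable M" "0 < t \<omega> \<and> t \<omega> \<le> 1" for \<omega>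
    unfolding t_def by auto
  have q_le: "AE \<omega> in M. \<forall>m. \<bar>q m \<omega>\<bar> * t \<omega> \<le> 2 * \<bar>F \<omega> (t \<omega>) - F \<omega> 0\<bar>"
    using q_lim
  proof eventually_elim
    case (elim \<omega>)
    have bdd: "bdd_above (range (\<lambda>n. \<bar>q n \<omega>\<bar>))"
      using convergent_imp_Bseq[OF convergentI[OF elim]]
      by (auto simp: Bseq_def intro: bdd_aboveI)
    define S where "S = (SUP n. \<bar>q n \<omega>\<bar>)"
    have S: "\<bar>q n \<omega>\<bar> \<le> S" for n
      unfolding S_def using bdd by (rule cSUP_upper[OF UNIV_I])
    \<comment> \<open>The supremum may not be attained, hence the factor 2: if \<open>S\<close> is
      positive, some quotient exceeds \<open>S / 2\<close>; otherwise all quotients vanish and any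
      index will do.\<close>
    have "\<exists>n. \<forall>m. \<bar>q m \<omega>\<bar> \<le> 2 * \<bar>q n \<omega>\<bar>"
    proof (cases "S \<le> 0")
      case True
      then show ?thesis
        using S by (metis abs_ge_zero mult_nonneg_nonneg order_trans zero_le_numeral)
    next
      case False
      then have "S / 2 < (SUP n. \<bar>q n \<omega>\<bar>)"
        by (simp add: S_def)
      then obtain n where "S / 2 < \<bar>q n \<omega>\<bar>"
        using bdd less_cSUP_iff[of UNIV "\<lambda>n. \<bar>q n \<omega>\<bar>" "S / 2"] by blast
      then have "\<bar>q m \<omega>\<bar> \<le> 2 * \<bar>q n \<omega>\<bar>" for m
        using S[of m] by linarith
      then show ?thesis
        by blast
    qed
    then have "\<forall>m. \<bar>q m \<omega>\<bar> \<le> 2 * \<bar>q (N \<omega>) \<omega>\<bar>"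
      unfolding N_def by (rule LeastI_ex)
    moreover have "\<bar>q (N \<omega>) \<omega>\<bar> * t \<omega> = \<bar>F \<omega> (t \<omega>) - F \<omega> 0\<bar>"
      by (simp add: q_def t_def abs_mult del: of_nat_Suc)
    moreover have "\<bar>q m \<omega>\<bar> * t \<omega> \<le> 2 * \<bar>q (N \<omega>) \<omega>\<bar> * t \<omega>" for m
      using calculation(1) t(2)[of \<omega>] by (intro mult_right_mono) auto
    ultimately show ?case
      by (simp only: mult.assoc simp_thms)
  qed
  obtain s where s: "s \<in> borel_measurable M" "\<And>\<omega>. 0 \<le> s \<omega> \<and> s \<omega> \<le> 1"
    and mv: "\<And>\<omega> D. (F \<omega> has_real_derivative D) (at (s \<omega>)) \<Longrightarrow> \<bar>F \<omega> (t \<omega>) - F \<omega> 0\<bar> \<le> \<bar>D\<bar> * t \<omega>"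
  proof (rule measurable_mean_value[of M F t])
    fix s :: "'a \<Rightarrow> real"
    assume "s \<in> borel_measurable M" "\<And>\<omega>. 0 \<le> s \<omega> \<and> s \<omega> \<le> 1"
    then show "(\<lambda>\<omega>. F \<omega> (s \<omega>)) \<in> borel_measurable M"
      using borel_measurable_integrable[OF Fint[of s]] by blast
  qed (rule t that; assumption)+
  \<comment> \<open>The gradient hypothesis is applied at the random point \<open>u + s d\<close> of
    \<open>L2\<close>; this makes the majorant
    \<open>2 * \<bar>k \<omega> \<bullet> d \<omega>\<bar>\<close> integrable.\<close>
  obtain k where k: "k \<in> L2 M"
    and k_eq: "AE \<omega> in M. k \<omega> = gradient (\<lambda>v. j v (\<xi> \<omega>)) (u \<omega> + s \<omega> *\<^sub>R d \<omega>)"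
    using grad[OF line[OF s]] by (auto simp: represents_partial_gradient_def)
  have bound: "AE \<omega> in M. \<forall>m. \<bar>q m \<omega>\<bar> \<le> 2 * \<bar>k \<omega> \<bullet> d \<omega>\<bar>"
    using q_le deriv k_eq
  proof eventually_elim
    case (elim \<omega>)
    then have "\<bar>F \<omega> (t \<omega>) - F \<omega> 0\<bar> \<le> \<bar>k \<omega> \<bullet> d \<omega>\<bar> * t \<omega>"
      using mv[of \<omega> "k \<omega> \<bullet> d \<omega>"] by simp
    then have "\<bar>q m \<omega>\<bar> * t \<omega> \<le> (2 * \<bar>k \<omega> \<bullet> d \<omega>\<bar>) * t \<omega>" for m
      using spec[OF elim(1), of m] by (simp add: mult.assoc)
    then show ?case
      using t(2)[of \<omega>] by (auto intro: mult_right_le_imp_le)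
  qed
  have "(\<lambda>n. \<integral>\<omega>. q n \<omega> \<partial>M) \<longlonglongrightarrow> (\<integral>\<omega>. g \<omega> \<bullet> d \<omega> \<partial>M)"
  proof (rule integral_dominated_convergence)
    show "integrable M (\<lambda>\<omega>. 2 * \<bar>k \<omega> \<bullet> d \<omega>\<bar>)"
      using integrable_L2_inner[OF k d] by auto
    show "(\<lambda>\<omega>. g \<omega> \<bullet> d \<omega>) \<in> borel_measurable M"
      using integrable_L2_inner[OF g_L2 d] by auto
    show "AE \<omega> in M. norm (q n \<omega>) \<le> 2 * \<bar>k \<omega> \<bullet> d \<omega>\<bar>" for n
      using bound by eventually_elim simp
  qed (use q_lim in auto)
  moreover have "(\<integral>\<omega>. q n \<omega> \<partial>M)
      = real (Suc n) * (expected_cost M j \<xi> (\<lambda>\<omega>. u \<omega> + (1 / real (Suc n)) *\<^sub>R d \<omega>)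
        - expected_cost M j \<xi> u)" for n
    unfolding q_def using F_const[of "1 / real (Suc n)"] F_const[of 0]
    by (simp add: expected_cost_def F_def del: of_nat_Suc)
  ultimately show ?thesis
    by (simp only: L2_inner_def)
qed

section \<open>The optimality condition\<close>

theorem theorem1p4:
  fixes M G :: "'a measure"
    and \<xi> :: "'a \<Rightarrow> real ^ 'dx"
    and j :: "real ^ 'du \<Rightarrow> real ^ 'dx \<Rightarrow> real"
    and \<Gamma> :: "'a \<Rightarrow> (real ^ 'du) set"
    and u_opt g :: "'a \<Rightarrow> real ^ 'du"
  assumes "prob_space M"
    and "subalgebra M G"
    and "\<xi> \<in> borel_measurable M"
    and "normal_integrand borel (\<lambda>x u. j u x)"
    and J_finite: "\<And>u. u \<in> L2 M \<Longrightarrow> integrable M (\<lambda>\<omega>. j (u \<omega>) (\<xi> \<omega>))"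
    and "measurable_set_valued G \<Gamma>"
    and "\<And>\<omega>. \<omega> \<in> space M \<Longrightarrow> closed (\<Gamma> \<omega>) \<and> convex (\<Gamma> \<omega>)"
    and "AE \<omega> in M. \<forall>v. (\<lambda>u. j u (\<xi> \<omega>)) differentiable (at v)"
    and "\<And>u. u \<in> L2 M \<Longrightarrow> \<exists>h. represents_partial_gradient M j \<xi> u h"
    and "is_arg_min (expected_cost M j \<xi>) (\<lambda>u. u \<in> U_as M \<Gamma> \<inter> U_me M G) u_opt"
    and "represents_partial_gradient M j \<xi> u_opt g"
  shows "vec_cond_exp M G g \<in> uminus ` subdifferential M (chi (U_as M \<Gamma>)) u_opt"
proof -
  interpret prob_space M by fact
  interpret finite_measure_subalgebra M G
    by unfold_locales fact
  have space_G: "space G = space M"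
    using assms(2) by (simp add: subalgebra_def)
  let ?J = "expected_cost M j \<xi>"
  let ?p = "vec_cond_exp M G g"
  have g: "g \<in> L2 M"
    using assms(11) by (simp add: represents_partial_gradient_def)
  have p: "?p \<in> L2 M" and p_G: "?p \<in> borel_measurable G"
    by (rule vec_cond_exp_L2[OF g], rule borel_measurable_vec_cond_exp)
  have u: "u_opt \<in> L2 M" and u_\<Gamma>: "AE \<omega> in M. u_opt \<omega> \<in> \<Gamma> \<omega>"
    and opt: "\<And>v. v \<in> U_as M \<Gamma> \<inter> U_me M G \<Longrightarrow> ?J u_opt \<le> ?J v"
    using assms(10) by (auto simp: is_arg_min_linorder U_as_def)
  \<comment> \<open>\<open>u_opt\<close> may differ from a \<open>G\<close>-measurable function on a
    null set; projecting from \<open>u'\<close> keeps the projection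
    \<open>G\<close>-measurable.\<close>
  obtain u' where u'[measurable]: "u' \<in> borel_measurable G" and u_eq: "AE \<omega> in M. u_opt \<omega> = u' \<omega>"
    using assms(10) by (auto simp: is_arg_min_def U_me_def)
  have [measurable]: "u' \<in> borel_measurable M"
    using measurable_from_subalg[OF assms(2) u'] .
  have u'_L2: "u' \<in> L2 M"
    by (rule L2_bound[OF _ u]) (use u_eq in auto)

  \<comment> \<open>\<open>closest_point\<close> is unspecified on the empty set, so the null set where
    \<open>\<Gamma>\<close> is empty is removed first.\<close>
  define S where "S = (\<lambda>\<omega>. if \<omega> \<in> space M \<and> \<Gamma> \<omega> \<noteq> {} then \<Gamma> \<omega> else UNIV)"
  have S: "closed (S \<omega>)" "convex (S \<omega>)" "S \<omega> \<noteq> {}" for \<omega>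
    using assms(7) by (auto simp: S_def)
  have "measurable_set_valued G S"
    unfolding measurable_set_valued_def
  proof (intro allI impI)
    fix V :: "(real ^ 'du) set" assume "open V"
    then have [measurable]: "{\<omega> \<in> space G. \<Gamma> \<omega> \<inter> V \<noteq> {}} \<in> sets G"
      "{\<omega> \<in> space G. \<Gamma> \<omega> \<noteq> {}} \<in> sets G"
      using assms(6) measurable_set_valued_space by (auto simp: measurable_set_valued_def)
    \<comment> \<open>Where \<open>\<Gamma>\<close> is empty, \<open>S\<close> is the whole space
      and meets every nonempty \<open>V\<close>.\<close>
    have "{\<omega> \<in> space G. S \<omega> \<inter> V \<noteq> {}}
        = {\<omega> \<in> space G. \<Gamma> \<omega> \<inter> V \<noteq> {} \<or> (\<not> \<Gamma> \<omega> \<noteq> {} \<and> V \<noteq> {})}"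
      by (auto simp: S_def space_G)
    also have "\<dots> \<in> sets G"
      by measurable
    finally show "{\<omega> \<in> space G. S \<omega> \<inter> V \<noteq> {}} \<in> sets G" .
  qed
  then have S_meas: "(\<lambda>\<omega>. closest_point (S \<omega>) (u' \<omega> - ?p \<omega>)) \<in> borel_measurable G"
    by (intro borel_measurable_closest_point S borel_measurable_diff u' p_G)

  \<comment> \<open>A point \<open>u\<close> of a closed convex set is the projection of
    \<open>u - p\<close> exactly when \<open>- p\<close> is normal to the set at \<open>u\<close>;
    \<open>d\<close> measures the failure of this fixed-point equation.\<close>
  define y where "y = (\<lambda>\<omega>. closest_point (S \<omega>) (u' \<omega> - ?p \<omega>))"
  define d where "d = (\<lambda>\<omega>. y \<omega> - u' \<omega>)"
  have d_G[measurable]: "d \<in> borel_measurable G"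
    unfolding d_def y_def by (intro borel_measurable_diff S_meas u')
  have [measurable]: "d \<in> borel_measurable M"
    using measurable_from_subalg[OF assms(2) d_G] .
  have S_\<Gamma>: "AE \<omega> in M. S \<omega> = \<Gamma> \<omega>"
    using u_\<Gamma> AE_space by eventually_elim (auto simp: S_def)
  have y_\<Gamma>: "AE \<omega> in M. y \<omega> \<in> \<Gamma> \<omega>"
    using S_\<Gamma> by eventually_elim (metis S(1,3) closest_point_in_set y_def)
  have variational: "AE \<omega> in M. \<forall>z\<in>\<Gamma> \<omega>. (- ?p \<omega> - d \<omega>) \<bullet> (z - y \<omega>) \<le> 0"
    using S_\<Gamma>
  proof eventually_elim
    case (elim \<omega>)
    have "- ?p \<omega> - d \<omega> = u' \<omega> - ?p \<omega> - y \<omega>"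
      by (simp add: d_def)
    moreover have "(u' \<omega> - ?p \<omega> - y \<omega>) \<bullet> (z - y \<omega>) \<le> 0" if "z \<in> S \<omega>" for z
      unfolding y_def by (rule closest_point_dot[OF S(2,1) that])
    ultimately show ?case
      using elim by metis
  qed
  have d_le: "AE \<omega> in M. (norm (d \<omega>))\<^sup>2 \<le> - (?p \<omega> \<bullet> d \<omega>)"
    using variational u_\<Gamma> u_eq
  proof eventually_elim
    case (elim \<omega>)
    \<comment> \<open>The variational inequality is tested at \<open>z = u' \<omega>\<close>, where
      \<open>z - y \<omega>\<close> is \<open>- d \<omega>\<close>.\<close>
    then have "(- ?p \<omega> - d \<omega>) \<bullet> (- d \<omega>) \<le> 0"
      by (metis d_def minus_diff_eq)
    then show ?case
      by (simp add: inner_diff_left power2_norm_eq_inner)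
  qed
  \<comment> \<open>By Cauchy-Schwarz, \<open>d_le\<close> bounds the norm of \<open>d\<close> by
    that of \<open>?p\<close>; the sets \<open>\<Gamma> \<omega>\<close> may be unbounded.\<close>
  have d_L2: "d \<in> L2 M"
  proof (rule L2_bound[OF _ p])
    show "AE \<omega> in M. norm (d \<omega>) \<le> norm (?p \<omega>)"
      using d_le
    proof eventually_elim
      case (elim \<omega>)
      then have "norm (d \<omega>) * norm (d \<omega>) \<le> norm (?p \<omega>) * norm (d \<omega>)"
        using Cauchy_Schwarz_ineq2[of "?p \<omega>" "d \<omega>"] by (simp add: power2_eq_square)
      then show ?case
        by (metis mult_right_le_imp_le norm_ge_zero zero_less_norm_iff norm_zero)
    qed
  qed simp

  \<comment> \<open>The point is almost surely the convex combination of \<open>u_opt\<close> and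
    \<open>y\<close> with weights \<open>1 - t\<close> and \<open>t\<close>, and
    \<open>u' + t d\<close> is a \<open>G\<close>-measurable representative.\<close>
  have feasible: "(\<lambda>\<omega>. u_opt \<omega> + t *\<^sub>R d \<omega>) \<in> U_as M \<Gamma> \<inter> U_me M G" if t: "0 \<le> t" "t \<le> 1" for t
  proof -
    have "(\<lambda>\<omega>. u_opt \<omega> + t *\<^sub>R d \<omega>) \<in> L2 M"
      using L2_add[OF u L2_scaleR_bounded[OF d_L2, of "\<lambda>_. t"]] t by simp
    moreover have "AE \<omega> in M. u_opt \<omega> + t *\<^sub>R d \<omega> \<in> \<Gamma> \<omega>"
      using u_\<Gamma> y_\<Gamma> u_eq AE_space
    proof eventually_elim
      case (elim \<omega>)
      then have "(1 - t) *\<^sub>R u_opt \<omega> + t *\<^sub>R y \<omega> \<in> \<Gamma> \<omega>"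
        using assms(7) t by (intro convexD_alt) auto
      then show ?case
        using elim(3) by (simp add: d_def algebra_simps)
    qed
    moreover have "\<exists>w\<in>borel_measurable G. AE \<omega> in M. u_opt \<omega> + t *\<^sub>R d \<omega> = w \<omega>"
    proof (intro bexI)
      show "(\<lambda>\<omega>. u' \<omega> + t *\<^sub>R d \<omega>) \<in> borel_measurable G"
        by simp
      show "AE \<omega> in M. u_opt \<omega> + t *\<^sub>R d \<omega> = u' \<omega> + t *\<^sub>R d \<omega>"
        using u_eq by eventually_elim simp
    qed
    ultimately show ?thesis
      unfolding U_as_def U_me_def by simp
  qed
  \<comment> \<open>The steps \<open>1 / (n + 1)\<close> are at most 1, so every quotient compares
    \<open>u_opt\<close> with a feasible point and is nonnegative.\<close>
  have "0 \<le> L2_inner M g d"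
  proof (rule LIMSEQ_le_const)
    show "(\<lambda>n. real (Suc n) * (?J (\<lambda>\<omega>. u_opt \<omega> + (1 / real (Suc n)) *\<^sub>R d \<omega>) - ?J u_opt))
        \<longlonglongrightarrow> L2_inner M g d"
      by (rule expected_cost_directional_derivative) (use assms u d_L2 in auto)
    show "\<exists>N. \<forall>n\<ge>N. 0 \<le> real (Suc n)
        * (?J (\<lambda>\<omega>. u_opt \<omega> + (1 / real (Suc n)) *\<^sub>R d \<omega>) - ?J u_opt)"
      using opt[OF feasible] by auto
  qed
  \<comment> \<open>As \<open>d\<close> is \<open>G\<close>-measurable, \<open>g\<close> may be
    replaced by \<open>?p\<close>. Integrating \<open>d_le\<close> then squeezes the squared norm of
    \<open>d\<close> between 0 and a nonpositive number.\<close>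
  then have "0 \<le> (\<integral>\<omega>. ?p \<omega> \<bullet> d \<omega> \<partial>M)"
    using L2_inner_vec_cond_exp[OF g d_L2 d_G] by (simp add: L2_inner_def)
  moreover have d_sq: "integrable M (\<lambda>\<omega>. (norm (d \<omega>))\<^sup>2)"
    using d_L2 by (simp add: L2_def)
  moreover have "(\<integral>\<omega>. (norm (d \<omega>))\<^sup>2 \<partial>M) \<le> (\<integral>\<omega>. - (?p \<omega> \<bullet> d \<omega>) \<partial>M)"
    using integrable_L2_inner[OF p d_L2] d_le by (intro integral_mono_AE d_sq) auto
  moreover have "0 \<le> (\<integral>\<omega>. (norm (d \<omega>))\<^sup>2 \<partial>M)"
    by simp
  ultimately have "(\<integral>\<omega>. (norm (d \<omega>))\<^sup>2 \<partial>M) = 0"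
    unfolding Bochner_Integration.integral_minus by linarith
  then have d_0: "AE \<omega> in M. d \<omega> = 0"
    using integral_nonneg_eq_0_iff_AE[OF d_sq] by simp
  \<comment> \<open>With \<open>d = 0\<close>, the projection \<open>y\<close> coincides with
    \<open>u_opt\<close>, and the variational inequality says that \<open>- ?p\<close> is normal
    there.\<close>
  have normal: "AE \<omega> in M. \<forall>z\<in>\<Gamma> \<omega>. - ?p \<omega> \<bullet> (z - u_opt \<omega>) \<le> 0"
    using variational d_0 u_eq by eventually_elim (simp add: d_def)
  \<comment> \<open>Pointwise normality tests against all of \<open>\<Gamma> \<omega>\<close>, so
    \<open>v\<close> ranges over the whole of \<open>U_as\<close> and not only over its
    \<open>G\<close>-measurable members.\<close>
  have "L2_inner M (- ?p) (v - u_opt) \<le> 0" if "v \<in> U_as M \<Gamma>" for v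
  proof -
    have "AE \<omega> in M. v \<omega> \<in> \<Gamma> \<omega>"
      using that by (simp add: U_as_def)
    with normal have "AE \<omega> in M. 0 \<le> ?p \<omega> \<bullet> (v \<omega> - u_opt \<omega>)"
      by eventually_elim (simp add: inner_minus_left)
    then have "0 \<le> (\<integral>\<omega>. ?p \<omega> \<bullet> (v \<omega> - u_opt \<omega>) \<partial>M)"
      by (rule integral_nonneg_AE)
    then show ?thesis
      by (simp add: L2_inner_def inner_minus_left)
  qed
  moreover have "- ?p \<in> L2 M"
    using L2_uminus[OF p] by (simp add: fun_Compl_def)
  moreover have "U_as M \<Gamma> \<subseteq> L2 M" "u_opt \<in> U_as M \<Gamma>"
    using u u_\<Gamma> by (auto simp: U_as_def)
  ultimately have "- ?p \<in> subdifferential M (chi (U_as M \<Gamma>)) u_opt"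
    by (simp add: subdifferential_chi)
  then show ?thesis
    by (rule rev_image_eqI) (simp add: fun_eq_iff)
qed

end
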